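(* Let $L$ be convex concave, let $(p,q)\in\mathrm{Solution}(L)$ with $p=(p_1,\dots,p_n)$, $q=(q_1,\dots,q_m)$, and let $(\theta(0),\phi(0))$ be an initialization that is safe for $(p,q)$. Then the quantity $$H(u,v)=\sum_{i=1}^{n}\int_{p_i}^{u_i}\frac{z-p_i}{\|\nabla f_i(X_{\theta_i(0)}(z))\|^2}\,dz+\sum_{j=1}^{m}\int_{q_j}^{v_j}\frac{z-q_j}{\|\nabla g_j(X_{\phi_j(0)}(z))\|^2}\,dz$$ is non-increasing along the solutions of the induced dynamics $$\dot u_i=-\|\nabla f_i(X_{\theta_i(0)}(u_i))\|^2\,\frac{\partial L}{\partial x_i}(u,v),\qquad \dot v_j=\|\nabla g_j(X_{\phi_j(0)}(v_j))\|^2\,\frac{\partial L}{\partial y_j}(u,v)$$ ($1\le i\le n$, $1\le j\le m$) on the domain $D=\prod_{i=1}^n\operatorname{Im}_{f_i}(\theta_i(0))\times\prod_{j=1}^m\operatorname{Im}_{g_j}(\phi_j(0))$.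
   Context: Setting: $n,m,n_1,\dots,n_n,m_1,\dots,m_m$ are positive integers, $N=\sum_i n_i$, $M=\sum_j m_j$; $f_i:\mathbb{R}^{n_i}\to\mathbb{R}$, $g_j:\mathbb{R}^{m_j}\to\mathbb{R}$ and $L:\mathbb{R}^n\times\mathbb{R}^m\to\mathbb{R}$, $(x,y)\mapsto L(x,y)$, are $C^2$. Write $\theta=(\theta_1,\dots,\theta_n)\in\mathbb{R}^N$ with $\theta_i\in\mathbb{R}^{n_i}$ and $\phi=(\phi_1,\dots,\phi_m)\in\mathbb{R}^M$ with $\phi_j\in\mathbb{R}^{m_j}$. The norm is Euclidean. Convex concave: $L(\cdot,y)$ is convex for every $y\in\mathbb{R}^m$ and $L(x,\cdot)$ is concave for every $x\in\mathbb{R}^n$. $\mathrm{Solution}(L)$ is the set of equilibria (von Neumann solutions) of $L$: pairs $(p,q)$ with $L(p,y)\le L(p,q)\le L(x,q)$ for all $x\in\mathbb{R}^n,y\in\mathbb{R}^m$ (for convex concave $L$, equivalently the stationary points of $L$). Gradient ascent image: for $k:\mathbb{R}^d\to\mathbb{R}$ of class $C^2$ and $x_0\in\mathbb{R}^d$, let $x:\mathbb{R}\to\mathbb{R}^d$ be the solution of $\dot x=\nabla k(x)$, $x(0)=x_0$; $\operatorname{Im}_k(x_0)$ is the image of $k\circ x:\mathbb{R}\to\mathbb{R}$. The gradient ascent trajectories of the $f_i,g_j$ are assumed to be defined for all times $t\in\mathbb{R}$. Maps $X$: for $\theta_i(0)$ not a stationary point of $f_i$, $f_i$ is strictly increasing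 along the gradient ascent trajectory of $f_i$ through $\theta_i(0)$, and $X_{\theta_i(0)}:\operatorname{Im}_{f_i}(\theta_i(0))\to\mathbb{R}^{n_i}$ maps a value $z$ to the unique point of that trajectory at which $f_i$ equals $z$. $X_{\phi_j(0)}:\operatorname{Im}_{g_j}(\phi_j(0))\to\mathbb{R}^{m_j}$ is defined in the same way using gradient ascent on $g_j$. Safe: $(\theta(0),\phi(0))$ is safe for $(p,q)\in\mathrm{Solution}(L)$ if no $\theta_i(0)$ is a stationary point of $f_i$, no $\phi_j(0)$ is a stationary point of $g_j$, and $p_i\in\operatorname{Im}_{f_i}(\theta_i(0))$, $q_j\in\operatorname{Im}_{g_j}(\phi_j(0))$ for all $i,j$. *)

theory Defs
  imports "HOL-Analysis.Analysis"
begin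

definition C2 :: "('a::euclidean_space \<Rightarrow> real) \<Rightarrow> bool" where
  "C2 k \<longleftrightarrow>
     (\<exists>(k' :: 'a \<Rightarrow> 'a \<Rightarrow>\<^sub>L real) (k'' :: 'a \<Rightarrow> 'a \<Rightarrow>\<^sub>L 'a \<Rightarrow>\<^sub>L real).
        (\<forall>x. (k has_derivative blinfun_apply (k' x)) (at x)) \<and>
        (\<forall>x. (k' has_derivative blinfun_apply (k'' x)) (at x)) \<and>
        continuous_on UNIV k'')"

definition grad :: "('a::euclidean_space \<Rightarrow> real) \<Rightarrow> 'a \<Rightarrow> 'a" where
  "grad k x = (THE D. GDERIV k x :> D)"

definition stationary_point :: "('a::euclidean_space \<Rightarrow> real) \<Rightarrow> 'a \<Rightarrow> bool" where
  "stationary_point k x \<longleftrightarrow> grad k x = 0"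

text \<open>
  The parameter space \<open>\<real>\<^sup>N\<close> with \<open>N = n\<^sub>1 + \<dots> + n\<^sub>n\<close> is \<open>real ^ 'N\<close>, and a surjection
  \<open>\<beta> :: 'N \<Rightarrow> 'n\<close> says which block each coordinate belongs to, so that \<open>n\<^sub>i\<close> is the
  (positive) number of \<open>k\<close> with \<open>\<beta> k = i\<close>. The space \<open>\<real>\<close> to the power \<open>n\<^sub>i\<close> is
  identified with the vectors supported on block \<open>i\<close>; a function of \<open>\<theta>\<^sub>i\<close> alone is a function on
  \<open>real ^ 'N\<close> that depends only on the coordinates in block \<open>i\<close>. Its gradient is supported on
  block \<open>i\<close>, so gradient, norm and gradient trajectories starting in block \<open>i\<close> are those of the
  function on the block.
\<close>

definition block :: "('N::finite \<Rightarrow> 'n) \<Rightarrow> real ^ 'N \<Rightarrow> 'n \<Rightarrow> real ^ 'N" where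
  "block \<beta> \<theta> i = (\<chi> k. if \<beta> k = i then \<theta> $ k else 0)"

definition depends_on_block :: "('N::finite \<Rightarrow> 'n) \<Rightarrow> 'n \<Rightarrow> (real ^ 'N \<Rightarrow> real) \<Rightarrow> bool" where
  "depends_on_block \<beta> i k \<longleftrightarrow> (\<forall>\<theta>. k (block \<beta> \<theta> i) = k \<theta>)"

definition gradient_ascent ::
  "('a::euclidean_space \<Rightarrow> real) \<Rightarrow> 'a \<Rightarrow> (real \<Rightarrow> 'a) \<Rightarrow> bool" where
  "gradient_ascent k x0 x \<longleftrightarrow>
     x 0 = x0 \<and> (\<forall>t. (x has_vector_derivative grad k (x t)) (at t))"

definition global_gradient_ascent :: "('a::euclidean_space \<Rightarrow> real) \<Rightarrow> bool" where
  "global_gradient_ascent k \<longleftrightarrow> (\<forall>x0. \<exists>x. gradient_ascent k x0 x)"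

definition ascent_traj :: "('a::euclidean_space \<Rightarrow> real) \<Rightarrow> 'a \<Rightarrow> real \<Rightarrow> 'a" where
  "ascent_traj k x0 = (THE x. gradient_ascent k x0 x)"

definition ascent_image :: "('a::euclidean_space \<Rightarrow> real) \<Rightarrow> 'a \<Rightarrow> real set" where
  "ascent_image k x0 = range (k \<circ> ascent_traj k x0)"

text \<open>The map \<open>X\<close>; it is meaningful for \<open>x0\<close> not stationary and \<open>z \<in> ascent_image k x0\<close>.\<close>

definition ascent_point :: "('a::euclidean_space \<Rightarrow> real) \<Rightarrow> 'a \<Rightarrow> real \<Rightarrow> 'a" where
  "ascent_point k x0 z = (THE y. y \<in> range (ascent_traj k x0) \<and> k y = z)"

definition convex_concave :: "((real ^ 'n::finite) \<times> (real ^ 'm::finite) \<Rightarrow> real) \<Rightarrow> bool" where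
  "convex_concave L \<longleftrightarrow>
     (\<forall>y. convex_on UNIV (\<lambda>x. L (x, y))) \<and> (\<forall>x. concave_on UNIV (\<lambda>y. L (x, y)))"

definition Solution ::
  "((real ^ 'n::finite) \<times> (real ^ 'm::finite) \<Rightarrow> real) \<Rightarrow> ((real ^ 'n) \<times> (real ^ 'm)) set" where
  "Solution L = {(p, q). \<forall>x y. L (p, y) \<le> L (p, q) \<and> L (p, q) \<le> L (x, q)}"

definition partial_x ::
  "((real ^ 'n::finite) \<times> (real ^ 'm::finite) \<Rightarrow> real) \<Rightarrow> 'n \<Rightarrow> real ^ 'n \<Rightarrow> real ^ 'm \<Rightarrow> real"
  where "partial_x L i x y = deriv (\<lambda>h. L (x + h *\<^sub>R axis i 1, y)) 0"

definition partial_y ::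
  "((real ^ 'n::finite) \<times> (real ^ 'm::finite) \<Rightarrow> real) \<Rightarrow> 'm \<Rightarrow> real ^ 'n \<Rightarrow> real ^ 'm \<Rightarrow> real"
  where "partial_y L j x y = deriv (\<lambda>h. L (x, y + h *\<^sub>R axis j 1)) 0"

text \<open>
  Below, \<open>a i\<close> and \<open>b j\<close> stand for the initial points of the blocks \<open>\<theta>\<^sub>i(0)\<close> and \<open>\<phi>\<^sub>j(0)\<close>.
\<close>

definition domain ::
  "('n::finite \<Rightarrow> 'a::euclidean_space \<Rightarrow> real) \<Rightarrow> ('n \<Rightarrow> 'a) \<Rightarrow>
   ('m::finite \<Rightarrow> 'b::euclidean_space \<Rightarrow> real) \<Rightarrow> ('m \<Rightarrow> 'b) \<Rightarrow>
   ((real ^ 'n) \<times> (real ^ 'm)) set" where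
  "domain f a g b =
     {(u, v). (\<forall>i. u $ i \<in> ascent_image (f i) (a i)) \<and>
              (\<forall>j. v $ j \<in> ascent_image (g j) (b j))}"

definition safe ::
  "('n::finite \<Rightarrow> 'a::euclidean_space \<Rightarrow> real) \<Rightarrow> ('n \<Rightarrow> 'a) \<Rightarrow>
   ('m::finite \<Rightarrow> 'b::euclidean_space \<Rightarrow> real) \<Rightarrow> ('m \<Rightarrow> 'b) \<Rightarrow>
   real ^ 'n \<Rightarrow> real ^ 'm \<Rightarrow> bool" where
  "safe f a g b p q \<longleftrightarrow>
     (\<forall>i. \<not> stationary_point (f i) (a i)) \<and> (\<forall>j. \<not> stationary_point (g j) (b j)) \<and>
     (\<forall>i. p $ i \<in> ascent_image (f i) (a i)) \<and> (\<forall>j. q $ j \<in> ascent_image (g j) (b j))"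

text \<open>
  The set \<open>T\<close> is the time interval on which the solution is considered; derivatives at an end
  point belonging to \<open>T\<close> are one-sided.
\<close>

definition induced_solution ::
  "('n::finite \<Rightarrow> 'a::euclidean_space \<Rightarrow> real) \<Rightarrow> ('n \<Rightarrow> 'a) \<Rightarrow>
   ('m::finite \<Rightarrow> 'b::euclidean_space \<Rightarrow> real) \<Rightarrow> ('m \<Rightarrow> 'b) \<Rightarrow>
   ((real ^ 'n) \<times> (real ^ 'm) \<Rightarrow> real) \<Rightarrow>
   real set \<Rightarrow> (real \<Rightarrow> real ^ 'n) \<Rightarrow> (real \<Rightarrow> real ^ 'm) \<Rightarrow> bool" where
  "induced_solution f a g b L T u v \<longleftrightarrow>
     (\<forall>t\<in>T. (u t, v t) \<in> domain f a g b) \<and>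
     (\<forall>t\<in>T. \<forall>i. ((\<lambda>s. u s $ i) has_real_derivative
        - (norm (grad (f i) (ascent_point (f i) (a i) (u t $ i))))\<^sup>2 * partial_x L i (u t) (v t))
        (at t within T)) \<and>
     (\<forall>t\<in>T. \<forall>j. ((\<lambda>s. v s $ j) has_real_derivative
        (norm (grad (g j) (ascent_point (g j) (b j) (v t $ j))))\<^sup>2 * partial_y L j (u t) (v t))
        (at t within T))"

text \<open>The interval integral is oriented, so \<open>u $ i < p $ i\<close> is allowed.\<close>

definition H ::
  "('n::finite \<Rightarrow> 'a::euclidean_space \<Rightarrow> real) \<Rightarrow> ('n \<Rightarrow> 'a) \<Rightarrow>
   ('m::finite \<Rightarrow> 'b::euclidean_space \<Rightarrow> real) \<Rightarrow> ('m \<Rightarrow> 'b) \<Rightarrow>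
   real ^ 'n \<Rightarrow> real ^ 'm \<Rightarrow> real ^ 'n \<Rightarrow> real ^ 'm \<Rightarrow> real" where
  "H f a g b p q u v =
     (\<Sum>i\<in>UNIV. LBINT z = p $ i..u $ i.
        (z - p $ i) / (norm (grad (f i) (ascent_point (f i) (a i) z)))\<^sup>2) +
     (\<Sum>j\<in>UNIV. LBINT z = q $ j..v $ j.
        (z - q $ j) / (norm (grad (g j) (ascent_point (g j) (b j) z)))\<^sup>2)"

end

theory Submission
  imports Defs
begin

text \<open>
  Each summand of \<open>H\<close> is a primitive of \<open>(z - p\<^sub>i) / \<parallel>\<nabla>f\<^sub>i(X z)\<parallel>\<^sup>2\<close>, and the induced dynamics
  multiplies the partial derivative of \<open>L\<close> by exactly \<open>\<parallel>\<nabla>f\<^sub>i(X z)\<parallel>\<^sup>2\<close>. The speeds cancel, and along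
  a solution
  \<open>dH/dt = - \<Sum>\<^sub>i (u\<^sub>i - p\<^sub>i) \<partial>L/\<partial>x\<^sub>i(u,v) + \<Sum>\<^sub>j (v\<^sub>j - q\<^sub>j) \<partial>L/\<partial>y\<^sub>j(u,v)\<close>.
  Convexity in the first argument bounds the first term by \<open>L(p,v) - L(u,v)\<close>, concavity in the second
  bounds the second term by \<open>L(u,v) - L(u,q)\<close> (\<open>saddle_monotone\<close>), and the equilibrium property gives
  \<open>L(p,v) \<le> L(p,q) \<le> L(u,q)\<close>. Hence \<open>dH/dt \<le> 0\<close>.

  What needs care is that the summands of \<open>H\<close> are differentiable (\<open>energy_has_derivative\<close>). This is
  the fundamental theorem of calculus once the integrand is known to be continuous on an open interval
  containing the end points, that is, once \<open>z \<mapsto> \<parallel>\<nabla>f\<^sub>i(X z)\<parallel>\<^sup>2\<close> is continuous and positive on the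
  ascent image. Positivity holds because a trajectory reaching a stationary point would be constant by
  uniqueness of solutions (\<open>grad_nonzero_along_ascent\<close>). It also makes \<open>f\<^sub>i\<close> strictly increasing along
  the trajectory, so \<open>f\<^sub>i\<close> is a homeomorphism from the time axis onto the ascent image, and \<open>X\<close> is the
  trajectory composed with its inverse. Uniqueness of gradient trajectories follows from a Gronwall
  argument, since a gradient of class \<open>C\<^sup>1\<close> is Lipschitz on balls.
\<close>

section \<open>Gradients of \<open>C\<^sup>2\<close> functions\<close>

lemma GDERIV_unique:
  assumes "GDERIV k x :> D" "GDERIV k x :> E"
  shows "D = E"
proof -
  have "(\<lambda>h. inner h D) = (\<lambda>h. inner h E)"
    using assms has_derivative_unique unfolding gderiv_def by blast
  then have "inner (D - E) D = inner (D - E) E"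
    by metis
  then have "inner (D - E) (D - E) = 0"
    by (simp only: inner_diff_right diff_self)
  then show ?thesis
    by simp
qed

lemma blinfun_eq_inner:
  fixes A :: "'a::euclidean_space \<Rightarrow>\<^sub>L real"
  shows "blinfun_apply A h = inner h (\<Sum>b\<in>Basis. A b *\<^sub>R b)"
proof -
  have "A h = A (\<Sum>b\<in>Basis. inner h b *\<^sub>R b)"
    by (simp add: euclidean_representation)
  also have "\<dots> = (\<Sum>b\<in>Basis. inner h b * A b)"
    by (simp add: blinfun.sum_right blinfun.scaleR_right)
  finally show ?thesis
    by (simp add: inner_sum_right mult.commute)
qed

lemma grad_of_derivative:
  fixes k :: "'a::euclidean_space \<Rightarrow> real" and A :: "'a \<Rightarrow>\<^sub>L real"
  assumes "(k has_derivative blinfun_apply A) (at x)"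
  shows "grad k x = (\<Sum>b\<in>Basis. A b *\<^sub>R b)"
proof -
  have "GDERIV k x :> (\<Sum>b\<in>Basis. A b *\<^sub>R b)"
    unfolding gderiv_def using assms
    by (rule has_derivative_eq_rhs) (rule ext, rule blinfun_eq_inner)
  then show ?thesis
    unfolding grad_def using GDERIV_unique by blast
qed

lemma inner_grad_of_derivative:
  fixes k :: "'a::euclidean_space \<Rightarrow> real" and A :: "'a \<Rightarrow>\<^sub>L real"
  assumes "(k has_derivative blinfun_apply A) (at x)"
  shows "inner h (grad k x) = A h"
  unfolding grad_of_derivative[OF assms] by (rule blinfun_eq_inner[symmetric])

lemma C2_has_grad:
  fixes k :: "'a::euclidean_space \<Rightarrow> real"
  assumes "C2 k"
  shows "(k has_derivative (\<lambda>h. inner h (grad k x))) (at x)"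
proof -
  obtain A :: "'a \<Rightarrow>\<^sub>L real" where A: "(k has_derivative blinfun_apply A) (at x)"
    using assms unfolding C2_def by blast
  then show ?thesis
    by (rule has_derivative_eq_rhs) (simp add: fun_eq_iff inner_grad_of_derivative[OF A])
qed

lemma C2_continuous_grad:
  fixes k :: "'a::euclidean_space \<Rightarrow> real"
  assumes "C2 k"
  shows "continuous_on UNIV (grad k)"
proof -
  obtain k' :: "'a \<Rightarrow> 'a \<Rightarrow>\<^sub>L real" and k'' :: "'a \<Rightarrow> 'a \<Rightarrow>\<^sub>L 'a \<Rightarrow>\<^sub>L real"
    where k': "\<And>x. (k has_derivative blinfun_apply (k' x)) (at x)"
      and k'': "\<And>x. (k' has_derivative blinfun_apply (k'' x)) (at x)"
    using assms unfolding C2_def by blast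
  have "continuous_on UNIV k'"
    using k'' by (meson continuous_at_imp_continuous_on has_derivative_continuous)
  then have "continuous_on UNIV (\<lambda>x. \<Sum>b\<in>Basis. k' x b *\<^sub>R b)"
    by (intro continuous_intros)
  moreover have "grad k = (\<lambda>x. \<Sum>b\<in>Basis. k' x b *\<^sub>R b)"
    using grad_of_derivative[OF k'] by blast
  ultimately show ?thesis by simp
qed

text \<open>
  The mean value inequality for the first derivative, whose own derivative is bounded on the compact
  ball, carries over to the gradient because the two correspond isometrically.
\<close>

lemma C2_grad_lipschitz_on_cball:
  fixes k :: "'a::euclidean_space \<Rightarrow> real"
  assumes "C2 k"
  obtains C where "\<And>x y. x \<in> cball 0 r \<Longrightarrow> y \<in> cball 0 r \<Longrightarrow>
    norm (grad k x - grad k y) \<le> C * norm (x - y)"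
proof -
  obtain k' :: "'a \<Rightarrow> 'a \<Rightarrow>\<^sub>L real" and k'' :: "'a \<Rightarrow> 'a \<Rightarrow>\<^sub>L 'a \<Rightarrow>\<^sub>L real"
    where k': "\<And>x. (k has_derivative blinfun_apply (k' x)) (at x)"
      and k'': "\<And>x. (k' has_derivative blinfun_apply (k'' x)) (at x)"
      and cont: "continuous_on UNIV k''"
    using assms unfolding C2_def by blast
  have "compact (k'' ` cball 0 r)"
    by (intro compact_continuous_image continuous_on_subset[OF cont]) auto
  then obtain C where C: "\<And>x. x \<in> cball 0 r \<Longrightarrow> norm (k'' x) \<le> C"
    by (meson bounded_iff compact_imp_bounded image_eqI)
  show thesis
  proof (rule that)
    fix x y :: 'a assume xy: "x \<in> cball 0 r" "y \<in> cball 0 r"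
    let ?d = "grad k x - grad k y"
    have lip: "norm (k' x - k' y) \<le> C * norm (x - y)"
    proof (rule differentiable_bound[OF convex_cball _ _ xy])
      show "(k' has_derivative blinfun_apply (k'' z)) (at z within cball 0 r)" for z
        using k'' has_derivative_at_withinI by blast
      show "onorm (blinfun_apply (k'' z)) \<le> C" if "z \<in> cball 0 r" for z
        using C[OF that] by (simp add: norm_blinfun.rep_eq)
    qed
    have "norm ?d * norm ?d = inner ?d (grad k x) - inner ?d (grad k y)"
      by (simp flip: inner_diff_right add: dot_square_norm power2_eq_square)
    also have "\<dots> = (k' x - k' y) ?d"
      by (simp add: inner_grad_of_derivative[OF k'] blinfun.diff_left)
    also have "\<dots> \<le> norm (k' x - k' y) * norm ?d"
      using norm_blinfun[of "k' x - k' y" ?d] by simp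
    finally have "norm ?d \<le> norm (k' x - k' y)"
      by (cases "?d = 0") auto
    then show "norm ?d \<le> C * norm (x - y)"
      using lip by simp
  qed
qed

section \<open>Uniqueness of gradient trajectories\<close>

text \<open>
  Gronwall's inequality in both time directions: \<open>e\<^bsup>-Kt\<^esup> D\<close> is non-increasing to the right of \<open>0\<close>,
  \<open>e\<^bsup>Kt\<^esup> D\<close> is non-decreasing to its left.
\<close>

lemma gronwall_zero:
  fixes D D' :: "real \<Rightarrow> real"
  assumes deriv: "\<And>s. \<bar>s\<bar> \<le> R \<Longrightarrow> (D has_real_derivative D' s) (at s)"
    and bound: "\<And>s. \<bar>s\<bar> \<le> R \<Longrightarrow> \<bar>D' s\<bar> \<le> K * D s"
    and nonneg: "0 \<le> D t" and zero: "D 0 = 0" and t: "\<bar>t\<bar> \<le> R"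
  shows "D t = 0"
proof (cases "0 \<le> t")
  case True
  have "D 0 * exp (- K * 0) \<ge> D t * exp (- K * t)"
  proof (rule DERIV_nonpos_imp_nonincreasing[OF True])
    fix s assume "0 \<le> s" "s \<le> t"
    then have s: "\<bar>s\<bar> \<le> R" using t by simp
    have "((\<lambda>s. D s * exp (- K * s)) has_real_derivative (D' s - K * D s) * exp (- K * s)) (at s)"
      by (rule derivative_eq_intros deriv s refl | simp add: algebra_simps)+
    moreover have "(D' s - K * D s) * exp (- K * s) \<le> 0"
      using bound[OF s] by (intro mult_nonpos_nonneg) auto
    ultimately show "\<exists>y. ((\<lambda>s. D s * exp (- K * s)) has_real_derivative y) (at s) \<and> y \<le> 0"
      by blast
  qed
  then have "D t * exp (- K * t) \<le> 0" using zero by simp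
  then show ?thesis
    using nonneg by (simp add: mult_le_0_iff)
next
  case False
  then have le: "t \<le> 0" by simp
  have "D t * exp (K * t) \<le> D 0 * exp (K * 0)"
  proof (rule DERIV_nonneg_imp_nondecreasing[OF le])
    fix s assume "t \<le> s" "s \<le> 0"
    then have s: "\<bar>s\<bar> \<le> R" using t by simp
    have "((\<lambda>s. D s * exp (K * s)) has_real_derivative (D' s + K * D s) * exp (K * s)) (at s)"
      by (rule derivative_eq_intros deriv s refl | simp add: algebra_simps)+
    moreover have "(D' s + K * D s) * exp (K * s) \<ge> 0"
      using bound[OF s] by (intro mult_nonneg_nonneg) auto
    ultimately show "\<exists>y. ((\<lambda>s. D s * exp (K * s)) has_real_derivative y) (at s) \<and> 0 \<le> y"
      by blast
  qed
  then have "D t * exp (K * t) \<le> 0" using zero by simp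
  then show ?thesis
    using nonneg by (simp add: mult_le_0_iff)
qed

lemma gradient_ascent_continuous:
  assumes "gradient_ascent k x0 x"
  shows "continuous_on S x"
  using assms unfolding gradient_ascent_def
  by (meson continuous_at_imp_continuous_on has_vector_derivative_continuous)

text \<open>
  On a bounded time interval both trajectories stay in a common ball, where the gradient is Lipschitz,
  so Gronwall applies to the squared distance.
\<close>

lemma gradient_ascent_unique:
  fixes k :: "'a::euclidean_space \<Rightarrow> real"
  assumes k: "C2 k" and x: "gradient_ascent k x0 x" and y: "gradient_ascent k x0 y"
  shows "x = y"
proof
  fix t :: real
  define R :: real where "R = \<bar>t\<bar>"
  have "compact (x ` {-R..R} \<union> y ` {-R..R})"
    using gradient_ascent_continuous[OF x] gradient_ascent_continuous[OF y]
    by (intro compact_Un compact_continuous_image) auto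
  then obtain r where "\<And>z. z \<in> x ` {-R..R} \<union> y ` {-R..R} \<Longrightarrow> norm z \<le> r"
    by (meson bounded_iff compact_imp_bounded)
  then have r: "x s \<in> cball 0 r" "y s \<in> cball 0 r" if "\<bar>s\<bar> \<le> R" for s
    using that by (auto simp: abs_le_iff)
  obtain C where C: "\<And>a b. a \<in> cball 0 r \<Longrightarrow> b \<in> cball 0 r \<Longrightarrow>
      norm (grad k a - grad k b) \<le> C * norm (a - b)"
    using C2_grad_lipschitz_on_cball[OF k, of r] by blast
  let ?D = "\<lambda>s. inner (x s - y s) (x s - y s)"
  let ?D' = "\<lambda>s. 2 * inner (x s - y s) (grad k (x s) - grad k (y s))"
  have "?D t = 0"
  proof (rule gronwall_zero[where D = ?D and D' = ?D' and K = "2 * C" and R = R])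
    fix s assume s: "\<bar>s\<bar> \<le> R"
    have dx: "(x has_vector_derivative grad k (x s)) (at s)"
      and dy: "(y has_vector_derivative grad k (y s)) (at s)"
      using x y unfolding gradient_ascent_def by auto
    show "(?D has_real_derivative ?D' s) (at s)"
      using dx dy unfolding has_vector_derivative_def has_field_derivative_def
      by (auto intro!: derivative_eq_intros simp: inner_commute algebra_simps fun_eq_iff)
    have "\<bar>inner (x s - y s) (grad k (x s) - grad k (y s))\<bar>
        \<le> norm (x s - y s) * norm (grad k (x s) - grad k (y s))"
      by (rule Cauchy_Schwarz_ineq2)
    also have "\<dots> \<le> norm (x s - y s) * (C * norm (x s - y s))"
      using C r[OF s] by (intro mult_left_mono) auto
    also have "\<dots> = C * ?D s"
      by (simp add: dot_square_norm power2_eq_square)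
    finally show "\<bar>?D' s\<bar> \<le> 2 * C * ?D s"
      by (simp add: abs_mult)
  next
    show "?D 0 = 0"
      using x y unfolding gradient_ascent_def by simp
  qed (auto simp: R_def)
  then show "x t = y t" by simp
qed

lemma gradient_ascent_traj:
  assumes "C2 k" "global_gradient_ascent k"
  shows "gradient_ascent k x0 (ascent_traj k x0)"
proof -
  obtain x where x: "gradient_ascent k x0 x"
    using assms(2) unfolding global_gradient_ascent_def by blast
  then show ?thesis
    unfolding ascent_traj_def
    by (rule theI[where P = "gradient_ascent k x0"]) (rule gradient_ascent_unique[OF assms(1) _ x])
qed

text \<open>
  Restarted at a time when it visits a stationary point, the trajectory coincides with the constant
  one, so it never left that point and its initial point is stationary too.
\<close>

lemma grad_nonzero_along_ascent:
  fixes k :: "'a::euclidean_space \<Rightarrow> real"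
  assumes k: "C2 k" and x: "gradient_ascent k x0 x" and x0: "\<not> stationary_point k x0"
  shows "grad k (x s) \<noteq> 0"
proof
  assume zero: "grad k (x s) = 0"
  have "gradient_ascent k (x s) (\<lambda>t. x (s + t))"
  proof -
    have "((\<lambda>t. x (s + t)) has_vector_derivative grad k (x (s + t))) (at t)" for t
    proof -
      have "((\<lambda>t. s + t) has_vector_derivative 1) (at t)"
        by (auto intro!: derivative_eq_intros)
      moreover have "(x has_vector_derivative grad k (x (s + t))) (at (s + t))"
        using x unfolding gradient_ascent_def by blast
      ultimately show ?thesis
        using vector_diff_chain_at[of "\<lambda>t. s + t" 1 t x] by (simp add: o_def)
    qed
    then show ?thesis by (simp add: gradient_ascent_def)
  qed
  moreover have "gradient_ascent k (x s) (\<lambda>t. x s)"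
    by (simp add: gradient_ascent_def zero)
  ultimately have "(\<lambda>t. x (s + t)) = (\<lambda>t. x s)"
    by (rule gradient_ascent_unique[OF k])
  then have "x (s + - s) = x s" by (rule fun_cong)
  then have "x0 = x s"
    using x by (simp add: gradient_ascent_def)
  then show False
    using zero x0 by (simp add: stationary_point_def)
qed

section \<open>Parametrising a trajectory by the value of the function\<close>

lemma gradient_ascent_strict_mono:
  fixes k :: "'a::euclidean_space \<Rightarrow> real"
  assumes k: "C2 k" and x: "gradient_ascent k x0 x" and x0: "\<not> stationary_point k x0"
  shows "strict_mono (k \<circ> x)"
proof (rule strict_monoI)
  fix s t :: real assume "s < t"
  then show "(k \<circ> x) s < (k \<circ> x) t"
  proof (rule DERIV_pos_imp_increasing)
    fix r
    have "(x has_derivative (\<lambda>h. h *\<^sub>R grad k (x r))) (at r)"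
      using x unfolding gradient_ascent_def has_vector_derivative_def by blast
    then have "(k \<circ> x has_derivative (\<lambda>h. inner h (grad k (x r))) \<circ> (\<lambda>h. h *\<^sub>R grad k (x r))) (at r)"
      by (rule diff_chain_at) (rule C2_has_grad[OF k])
    then have "(k \<circ> x has_real_derivative inner (grad k (x r)) (grad k (x r))) (at r)"
      unfolding has_field_derivative_def
      by (rule has_derivative_eq_rhs) (simp add: fun_eq_iff)
    moreover have "0 < inner (grad k (x r)) (grad k (x r))"
      using grad_nonzero_along_ascent[OF k x x0] by simp
    ultimately show "\<exists>y. (k \<circ> x has_real_derivative y) (at r) \<and> 0 < y" by blast
  qed
qed

lemma gradient_ascent_value_continuous:
  fixes k :: "'a::euclidean_space \<Rightarrow> real"
  assumes k: "C2 k" and x: "gradient_ascent k x0 x"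
  shows "continuous_on UNIV (k \<circ> x)"
proof (rule continuous_on_compose)
  show "continuous_on UNIV x"
    by (rule gradient_ascent_continuous[OF x])
  show "continuous_on (range x) k"
    using C2_has_grad[OF k]
    by (meson continuous_at_imp_continuous_on has_derivative_continuous)
qed

lemma ascent_image_open_interval:
  assumes k: "C2 k" and glob: "global_gradient_ascent k" and x0: "\<not> stationary_point k x0"
  shows "open (ascent_image k x0)" and "is_interval (ascent_image k x0)"
proof -
  let ?h = "k \<circ> ascent_traj k x0"
  note x = gradient_ascent_traj[OF k glob, of x0]
  have inj: "inj ?h"
    by (rule strict_mono_imp_inj_on[OF gradient_ascent_strict_mono[OF k x x0]])
  show "open (ascent_image k x0)"
    unfolding ascent_image_def
    by (rule injective_into_1d_imp_open_map_UNIV[OF open_UNIV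
          gradient_ascent_value_continuous[OF k x] inj subset_UNIV])
  show "is_interval (ascent_image k x0)"
    unfolding ascent_image_def is_interval_connected_1
    by (rule connected_continuous_image[OF gradient_ascent_value_continuous[OF k x] connected_UNIV])
qed

text \<open>
  The value of \<open>k\<close> is a homeomorphism from the time axis onto the ascent image, and \<open>ascent_point\<close> is
  the trajectory composed with the inverse homeomorphism.
\<close>

lemma ascent_point_on_traj:
  assumes k: "C2 k" and glob: "global_gradient_ascent k" and x0: "\<not> stationary_point k x0"
  obtains \<tau> where "continuous_on (ascent_image k x0) \<tau>"
    and "\<And>z. z \<in> ascent_image k x0 \<Longrightarrow> ascent_point k x0 z = ascent_traj k x0 (\<tau> z)"
proof -
  let ?x = "ascent_traj k x0"
  note x = gradient_ascent_traj[OF k glob, of x0]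
  have inj: "inj (k \<circ> ?x)"
    by (rule strict_mono_imp_inj_on[OF gradient_ascent_strict_mono[OF k x x0]])
  then obtain \<tau> where \<tau>: "homeomorphism UNIV (ascent_image k x0) (k \<circ> ?x) \<tau>"
    using injective_into_1d_eq_homeomorphism[OF gradient_ascent_value_continuous[OF k x]]
    unfolding ascent_image_def by (auto simp: path_connected_UNIV)
  show thesis
  proof (rule that)
    show "continuous_on (ascent_image k x0) \<tau>"
      using \<tau> by (simp add: homeomorphism_def)
    fix z assume "z \<in> ascent_image k x0"
    then have "k (?x (\<tau> z)) = z"
      using \<tau> by (simp add: homeomorphism_def)
    moreover have "y = ?x (\<tau> z)" if "y \<in> range ?x" "k y = k (?x (\<tau> z))" for y
      using that inj by (auto simp: inj_def)
    ultimately show "ascent_point k x0 z = ?x (\<tau> z)"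
      unfolding ascent_point_def by (intro the_equality) auto
  qed
qed

lemma
  assumes k: "C2 k" and glob: "global_gradient_ascent k" and x0: "\<not> stationary_point k x0"
  shows grad_ascent_point_continuous:
      "continuous_on (ascent_image k x0) (\<lambda>z. grad k (ascent_point k x0 z))"
    and grad_ascent_point_nonzero:
      "z \<in> ascent_image k x0 \<Longrightarrow> grad k (ascent_point k x0 z) \<noteq> 0"
proof -
  obtain \<tau> where \<tau>: "continuous_on (ascent_image k x0) \<tau>"
    and pt: "\<And>z. z \<in> ascent_image k x0 \<Longrightarrow> ascent_point k x0 z = ascent_traj k x0 (\<tau> z)"
    using ascent_point_on_traj[OF k glob x0] by blast
  note x = gradient_ascent_traj[OF k glob, of x0]
  have "continuous_on (ascent_image k x0) (\<lambda>z. ascent_traj k x0 (\<tau> z))"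
    by (rule continuous_on_compose2[OF gradient_ascent_continuous[OF x, of UNIV] \<tau>]) simp
  then have "continuous_on (ascent_image k x0) (\<lambda>z. grad k (ascent_traj k x0 (\<tau> z)))"
    by (rule continuous_on_compose2[OF C2_continuous_grad[OF k]]) simp
  then show "continuous_on (ascent_image k x0) (\<lambda>z. grad k (ascent_point k x0 z))"
    by (rule continuous_on_eq) (simp add: pt)
  show "grad k (ascent_point k x0 z) \<noteq> 0" if "z \<in> ascent_image k x0"
    using grad_nonzero_along_ascent[OF k x x0] pt[OF that] by simp
qed

section \<open>Differentiating the summands of the energy\<close>

lemma interval_integral_has_derivative_open:
  fixes h :: "real \<Rightarrow> real"
  assumes I: "open I" "is_interval I" and h: "continuous_on I h" and "c \<in> I" "x \<in> I"
  shows "((\<lambda>u. LBINT z=c..u. h z) has_real_derivative h x) (at x)"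
proof -
  have "min c x \<in> I" "max c x \<in> I"
    using assms by (auto simp: min_def max_def)
  then obtain d e where d: "d > 0" "cball (min c x) d \<subseteq> I" and e: "e > 0" "cball (max c x) e \<subseteq> I"
    using \<open>open I\<close> open_contains_cball by metis
  \<comment> \<open>A compact interval with \<open>x\<close> in its interior, so that the derivative within it is the full one.\<close>
  define a b where "a = min c x - d" and "b = max c x + e"
  have "a \<in> I" "b \<in> I"
    using d e by (auto simp: a_def b_def dist_real_def)
  then have sub: "{a..b} \<subseteq> I"
    using I(2) mem_is_interval_1_I by (meson atLeastAtMost_iff subsetI)
  have ord: "a < c" "c < b" "a < x" "x < b"
    using d(1) e(1) by (auto simp: a_def b_def)
  have "((\<lambda>u. LBINT z=c..u. h z) has_vector_derivative h x) (at x within {a..b})"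
    using ord by (intro interval_integral_FTC2 continuous_on_subset[OF h sub]) auto
  then have "((\<lambda>u. LBINT z=c..u. h z) has_real_derivative h x) (at x within {a..b})"
    by (simp add: has_real_derivative_iff_has_vector_derivative)
  moreover have "at x within {a..b} = at x"
    using ord by (intro at_within_interior) simp
  ultimately show ?thesis by simp
qed

lemma energy_has_derivative:
  fixes k :: "'a::euclidean_space \<Rightarrow> real"
  assumes k: "C2 k" and glob: "global_gradient_ascent k" and x0: "\<not> stationary_point k x0"
    and c: "c \<in> ascent_image k x0" and w: "w \<in> ascent_image k x0"
  shows "((\<lambda>w. LBINT z=c..w. (z - c) / (norm (grad k (ascent_point k x0 z)))\<^sup>2)
      has_real_derivative (w - c) / (norm (grad k (ascent_point k x0 w)))\<^sup>2) (at w)"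
  using ascent_image_open_interval[OF k glob x0] _ c w
proof (rule interval_integral_has_derivative_open)
  show "continuous_on (ascent_image k x0) (\<lambda>z. (z - c) / (norm (grad k (ascent_point k x0 z)))\<^sup>2)"
    using grad_ascent_point_nonzero[OF k glob x0]
    by (intro continuous_intros grad_ascent_point_continuous[OF k glob x0]) auto
qed

text \<open>The squared gradient in the dynamics cancels the one in the integrand.\<close>

lemma energy_along_rescaled_flow:
  fixes k :: "'a::euclidean_space \<Rightarrow> real" and w :: "real \<Rightarrow> real"
  assumes "C2 k" "global_gradient_ascent k" "\<not> stationary_point k x0"
    and "c \<in> ascent_image k x0" and w: "w t \<in> ascent_image k x0"
    and dw: "(w has_real_derivative (norm (grad k (ascent_point k x0 (w t))))\<^sup>2 * r) (at t within S)"
  shows "((\<lambda>s. LBINT z=c..w s. (z - c) / (norm (grad k (ascent_point k x0 z)))\<^sup>2)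
      has_real_derivative (w t - c) * r) (at t within S)"
proof -
  let ?n = "(norm (grad k (ascent_point k x0 (w t))))\<^sup>2"
  have "((\<lambda>s. LBINT z=c..w s. (z - c) / (norm (grad k (ascent_point k x0 z)))\<^sup>2)
      has_real_derivative (w t - c) / ?n * (?n * r)) (at t within S)"
    by (rule DERIV_chain'[OF dw]) (rule energy_has_derivative[OF assms(1-5)])
  moreover have "?n \<noteq> 0"
    using grad_ascent_point_nonzero[OF assms(1-3) w] by simp
  ultimately show ?thesis by simp
qed

section \<open>Convex concave functions\<close>

lemma has_derivative_directional:
  assumes "(F has_derivative F') (at x)"
  shows "((\<lambda>h. F (x + h *\<^sub>R d)) has_real_derivative F' d) (at 0)"
proof -
  have "((\<lambda>h::real. x + h *\<^sub>R d) has_derivative (\<lambda>h. h *\<^sub>R d)) (at 0)"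
    by (auto intro!: derivative_eq_intros)
  then have "((\<lambda>h. F (x + h *\<^sub>R d)) has_derivative (\<lambda>h. F' (h *\<^sub>R d))) (at 0)"
    by (rule has_derivative_compose) (simp add: assms)
  then show ?thesis
    unfolding has_field_derivative_def
    by (rule has_derivative_eq_rhs)
      (simp add: fun_eq_iff linear_scale[OF has_derivative_linear[OF assms]] mult.commute)
qed

text \<open>
  A differentiable convex function lies above its tangent hyperplane, here with the derivative spelled
  out in partial derivatives. It reduces to the one-dimensional case on the line through \<open>x\<close> and \<open>y\<close>.
\<close>

lemma convex_on_above_tangent_partials:
  fixes F :: "real ^ 'n::finite \<Rightarrow> real"
  assumes conv: "convex_on UNIV F" and F': "(F has_derivative F') (at x)"
  shows "(\<Sum>i\<in>UNIV. (y $ i - x $ i) * deriv (\<lambda>h. F (x + h *\<^sub>R axis i 1)) 0) \<le> F y - F x"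
proof -
  have "deriv (\<lambda>h. F (x + h *\<^sub>R d)) 0 = F' d" for d
    by (rule DERIV_imp_deriv[OF has_derivative_directional[OF F']])
  then have "(\<Sum>i\<in>UNIV. (y $ i - x $ i) * deriv (\<lambda>h. F (x + h *\<^sub>R axis i 1)) 0)
      = (\<Sum>i\<in>UNIV. (y - x) $ i *\<^sub>R F' (axis i 1))"
    by simp
  also have "\<dots> = F' (\<Sum>i\<in>UNIV. (y - x) $ i *\<^sub>R axis i 1)"
    by (simp add: linear_sum[OF has_derivative_linear[OF F']]
        linear_scale[OF has_derivative_linear[OF F']])
  also have "(\<Sum>i\<in>UNIV. (y - x) $ i *\<^sub>R axis i 1) = y - x"
    using basis_expansion[of "y - x"] by (simp add: scalar_mult_eq_scaleR)
  also have "F' (y - x) \<le> F y - F x"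
  proof -
    have "convex_on UNIV (\<lambda>h::real. F (x + h *\<^sub>R (y - x)))"
    proof (rule convex_onI)
      fix t a b :: real assume t: "0 < t" "t < 1"
      have "x + ((1 - t) *\<^sub>R a + t *\<^sub>R b) *\<^sub>R (y - x)
          = (1 - t) *\<^sub>R (x + a *\<^sub>R (y - x)) + t *\<^sub>R (x + b *\<^sub>R (y - x))"
        by (simp add: algebra_simps)
      then show "F (x + ((1 - t) *\<^sub>R a + t *\<^sub>R b) *\<^sub>R (y - x))
          \<le> (1 - t) * F (x + a *\<^sub>R (y - x)) + t * F (x + b *\<^sub>R (y - x))"
        using convex_onD[OF conv, of t] t by simp
    qed simp
    from convex_on_imp_above_tangent[OF this connected_UNIV, of 0 1]
      has_derivative_directional[OF F', of "y - x"]
    show ?thesis by fastforce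
  qed
  finally show ?thesis .
qed

lemma C2_partial_x_differentiable:
  assumes "C2 L"
  obtains F' where "((\<lambda>x. L (x, y)) has_derivative F') (at x)"
proof -
  have "((\<lambda>x. (x, y)) has_derivative (\<lambda>h. (h, 0))) (at x)"
    by (auto intro!: derivative_eq_intros)
  then show thesis
    using has_derivative_compose[OF _ C2_has_grad[OF assms]] that by blast
qed

lemma C2_partial_y_differentiable:
  assumes "C2 L"
  obtains F' where "((\<lambda>y. L (x, y)) has_derivative F') (at y)"
proof -
  have "((\<lambda>y. (x, y)) has_derivative (\<lambda>h. (0, h))) (at y)"
    by (auto intro!: derivative_eq_intros)
  then show thesis
    using has_derivative_compose[OF _ C2_has_grad[OF assms]] that by blast
qed

text \<open>
  Gradient descent-ascent on \<open>L\<close> never points away from an equilibrium: adding the tangent inequalities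
  at \<open>(x, y)\<close> for \<open>L(\<cdot>, y)\<close> towards \<open>p\<close> and for \<open>-L(x, \<cdot>)\<close> towards \<open>q\<close> leaves the bound
  \<open>L(p, y) - L(x, q)\<close>, which the two equilibrium inequalities through \<open>L(p, q)\<close> make nonpositive.
\<close>

lemma saddle_monotone:
  fixes L :: "(real ^ 'n::finite) \<times> (real ^ 'm::finite) \<Rightarrow> real"
  assumes L: "C2 L" and cc: "convex_concave L" and sol: "(p, q) \<in> Solution L"
  shows "(\<Sum>i\<in>UNIV. (x $ i - p $ i) * - partial_x L i x y)
      + (\<Sum>j\<in>UNIV. (y $ j - q $ j) * partial_y L j x y) \<le> 0"
proof -
  have "(\<Sum>i\<in>UNIV. (x $ i - p $ i) * - partial_x L i x y)
      = (\<Sum>i\<in>UNIV. (p $ i - x $ i) * partial_x L i x y)"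
    by (intro sum.cong) (auto simp: algebra_simps)
  also have "\<dots> \<le> L (p, y) - L (x, y)"
  proof -
    obtain F' where "((\<lambda>x. L (x, y)) has_derivative F') (at x)"
      using C2_partial_x_differentiable[OF L] .
    moreover have "convex_on UNIV (\<lambda>x. L (x, y))"
      using cc by (simp add: convex_concave_def)
    ultimately show ?thesis
      using convex_on_above_tangent_partials unfolding partial_x_def by blast
  qed
  finally have A: "(\<Sum>i\<in>UNIV. (x $ i - p $ i) * - partial_x L i x y) \<le> L (p, y) - L (x, y)" .
  obtain G' where G': "((\<lambda>y. L (x, y)) has_derivative G') (at y)"
    using C2_partial_y_differentiable[OF L] .
  have partial: "deriv (\<lambda>h. - L (x, y + h *\<^sub>R axis j 1)) 0 = - partial_y L j x y" for j
    unfolding partial_y_def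
    using DERIV_imp_deriv[OF has_derivative_directional[OF G', of "axis j 1"]]
      DERIV_imp_deriv[OF has_derivative_directional[OF has_derivative_minus[OF G'], of "axis j 1"]]
    by simp
  have "convex_on UNIV (\<lambda>y. - L (x, y))"
    using cc by (simp add: convex_concave_def concave_on_def)
  then have "(\<Sum>j\<in>UNIV. (q $ j - y $ j) * - partial_y L j x y) \<le> - L (x, q) - - L (x, y)"
    using convex_on_above_tangent_partials[OF _ has_derivative_minus[OF G'], of q]
    unfolding partial by blast
  moreover have "(\<Sum>j\<in>UNIV. (q $ j - y $ j) * - partial_y L j x y)
      = (\<Sum>j\<in>UNIV. (y $ j - q $ j) * partial_y L j x y)"
    by (intro sum.cong) (auto simp: algebra_simps)
  ultimately have B: "(\<Sum>j\<in>UNIV. (y $ j - q $ j) * partial_y L j x y) \<le> L (x, y) - L (x, q)"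
    by simp
  have "L (p, y) \<le> L (p, q)" "L (p, q) \<le> L (x, q)"
    using sol by (auto simp: Solution_def)
  then show ?thesis
    using A B by linarith
qed

section \<open>The energy along the induced dynamics\<close>

lemma antimono_on_interval_of_derivative_nonpos:
  fixes h :: "real \<Rightarrow> real"
  assumes T: "is_interval T"
    and deriv: "\<And>t. t \<in> T \<Longrightarrow> (h has_real_derivative h' t) (at t within T)"
    and nonpos: "\<And>t. t \<in> T \<Longrightarrow> h' t \<le> 0"
  shows "antimono_on T h"
proof (rule monotone_onI)
  fix s t assume st: "s \<in> T" "t \<in> T" "s \<le> t"
  then have sub: "{s..t} \<subseteq> T"
    using T mem_is_interval_1_I by (meson atLeastAtMost_iff subsetI)
  have "(h has_derivative (*) (h' r)) (at r within {s..t})" if "s \<le> r" "r \<le> t" for r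
    using has_field_derivative_subset[OF deriv sub, of r] sub that
    unfolding has_field_derivative_def by auto
  then obtain r where "r \<in> {s..t}" "h t - h s = h' r * (t - s)"
    using mvt_very_simple[OF st(3), of h "\<lambda>r. (*) (h' r)"] by auto
  moreover from this have "h' r * (t - s) \<le> 0"
    using nonpos sub st(3) by (intro mult_nonpos_nonneg) auto
  ultimately show "h t \<le> h s" by simp
qed

theorem lemma2:
  fixes \<beta> :: "'N::finite \<Rightarrow> 'n::finite"
    and \<gamma> :: "'M::finite \<Rightarrow> 'm::finite"
    and f :: "'n \<Rightarrow> real ^ 'N \<Rightarrow> real"
    and g :: "'m \<Rightarrow> real ^ 'M \<Rightarrow> real"
    and L :: "(real ^ 'n) \<times> (real ^ 'm) \<Rightarrow> real"
    and p :: "real ^ 'n" and q :: "real ^ 'm"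
    and \<theta>0 :: "real ^ 'N" and \<phi>0 :: "real ^ 'M"
    and T :: "real set" and u :: "real \<Rightarrow> real ^ 'n" and v :: "real \<Rightarrow> real ^ 'm"
  assumes "surj \<beta>" and "surj \<gamma>"
    and "\<And>i. depends_on_block \<beta> i (f i)" and "\<And>j. depends_on_block \<gamma> j (g j)"
    and "\<And>i. C2 (f i)" and "\<And>j. C2 (g j)" and "C2 L"
    and "\<And>i. global_gradient_ascent (f i)" and "\<And>j. global_gradient_ascent (g j)"
    and "convex_concave L"
    and "(p, q) \<in> Solution L"
    and "safe f (block \<beta> \<theta>0) g (block \<gamma> \<phi>0) p q"
    and "is_interval T"
    and "induced_solution f (block \<beta> \<theta>0) g (block \<gamma> \<phi>0) L T u v"
  shows "antimono_on T (\<lambda>t. H f (block \<beta> \<theta>0) g (block \<gamma> \<phi>0) p q (u t) (v t))"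
proof -
  let ?a = "block \<beta> \<theta>0" and ?b = "block \<gamma> \<phi>0"
  let ?E = "\<lambda>k x0 c w. LBINT z=c..w. (z - c) / (norm (grad k (ascent_point k x0 z)))\<^sup>2"
  let ?H' = "\<lambda>t. (\<Sum>i\<in>UNIV. (u t $ i - p $ i) * - partial_x L i (u t) (v t))
      + (\<Sum>j\<in>UNIV. (v t $ j - q $ j) * partial_y L j (u t) (v t))"
  note safe = \<open>safe f ?a g ?b p q\<close>[unfolded safe_def]
  note ind = \<open>induced_solution f ?a g ?b L T u v\<close>[unfolded induced_solution_def domain_def]
  show ?thesis
    using \<open>is_interval T\<close>
  proof (rule antimono_on_interval_of_derivative_nonpos)
    fix t assume t: "t \<in> T"
    have U: "((\<lambda>s. ?E (f i) (?a i) (p $ i) (u s $ i)) has_real_derivative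
        (u t $ i - p $ i) * - partial_x L i (u t) (v t)) (at t within T)" for i
      using safe ind t assms(5,8) by (intro energy_along_rescaled_flow) auto
    have V: "((\<lambda>s. ?E (g j) (?b j) (q $ j) (v s $ j)) has_real_derivative
        (v t $ j - q $ j) * partial_y L j (u t) (v t)) (at t within T)" for j
      using safe ind t assms(6,9) by (intro energy_along_rescaled_flow) auto
    show "((\<lambda>t. H f ?a g ?b p q (u t) (v t)) has_real_derivative ?H' t) (at t within T)"
      unfolding H_def by (intro DERIV_add DERIV_sum U V)
    show "?H' t \<le> 0"
      by (rule saddle_monotone[OF \<open>C2 L\<close> \<open>convex_concave L\<close> \<open>(p, q) \<in> Solution L\<close>])
  qed
qed

end
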